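(* Let $\mathsf{PROP}$ be a fixed finite set of propositional symbols, let $\mathcal{C}$ be a class of finite pointed Kripke models over $\mathsf{PROP}$ (closed under isomorphism), and let $L\in\mathbb{N}$. The following are equivalent: (1) $\mathcal{C}$ is preserved under injective homomorphisms and invariant under $L$-unravelling; (2) $\mathcal{C}$ is definable by an $\exists^+\mathcal{GML}$ formula of modal depth at most $L$.
   Context: All models are finite. A Kripke model is $\mathfrak{M}=(W,R,V)$ with $W$ a non-empty finite set of worlds, $R\subseteq W\times W$, and $V$ mapping each $p\in\mathsf{PROP}$ to a subset of $W$. A pointed model is a pair $(\mathfrak{M},w)$ with $w\in W$. For pointed models $(\mathfrak{M},w)$, $(\mathfrak{N},v)$ with $\mathfrak{N}=(W',R',V')$, a homomorphism is a map $f:W\to W'$ with $f(w)=v$ such that for all $u,z\in W$ and $p\in\mathsf{PROP}$: $uRz$ implies $f(u)R'f(z)$, and $u\in V(p)$ implies $f(u)\in V'(p)$; it is an injective homomorphism if $f$ is injective. $\mathcal{C}$ is preserved under injective homomorphisms if $(\mathfrak{M},w)\in\mathcal{C}$ and an injective homomorphism from $(\mathfrak{M},w)$ to $(\mathfrak{N},v)$ exists imply $(\mathfrak{N},v)\in\mathcal{C}$. The $L$-unravelling $\mathsf{Unr}^L(\mathfrak{M},w)$ is the pointed model whose worlds are the tuples $(w,v_1,\dots,v_\ell)$ with $0\le\ell\le L$ and $wRv_1,\dots,v_{\ell-1}Rv_\ell$; the distinguished world is $(w)$; $(w,\dots,v_{\ell-1})$ is related to $(w,\dots,v_\ell)$ (and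 no other pairs); and $(w,v_1,\dots,v_\ell)$ satisfies $p$ iff $v_\ell\in V(p)$ ($v_0=w$). $\mathcal{C}$ is invariant under $L$-unravelling if $(\mathfrak{M},w)\in\mathcal{C}$ iff $\mathsf{Unr}^L(\mathfrak{M},w)\in\mathcal{C}$. Graded modal logic $\mathcal{GML}$: $\varphi ::= p\mid\neg\varphi\mid\varphi\wedge\varphi\mid\varphi\vee\varphi\mid\Diamond^{\ge k}\varphi$ ($k\ge1$), with $(\mathfrak{M},w)\models\Diamond^{\ge k}\varphi$ iff at least $k$ worlds $u$ with $wRu$ satisfy $\varphi$. Modal depth is the maximal nesting of $\Diamond^{\ge k}$. $\exists^+\mathcal{GML}$ is the negation-free fragment. $\mathcal{C}$ is definable by $\varphi$ if for all finite pointed models, $(\mathfrak{M},w)\models\varphi$ iff $(\mathfrak{M},w)\in\mathcal{C}$.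
   Formalization: The constants ⊤ and ⊥ are added to the formulas (without them the class of all models satisfies (1) but is not definable); the isomorphism-closed class is represented by its members whose worlds lie in an arbitrary fixed infinite set. *)

theory Defs
  imports Main
begin

record ('w, 'p) kripke =
  worlds :: "'w set"
  acc :: "('w \<times> 'w) set"
  val :: "'p \<Rightarrow> 'w set"

type_synonym ('w, 'p) pointed = "('w, 'p) kripke \<times> 'w"

text \<open>Symbols outside \<open>Props\<close> are given the empty extension, so that a model over \<open>Props\<close> carries
  no information beyond its valuation of \<open>Props\<close>.\<close>

definition kripke_model :: "'p set \<Rightarrow> ('w, 'p) kripke \<Rightarrow> bool" where
  "kripke_model Props M \<longleftrightarrow>
     finite (worlds M) \<and> worlds M \<noteq> {} \<and> acc M \<subseteq> worlds M \<times> worlds M \<and>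
     (\<forall>p\<in>Props. val M p \<subseteq> worlds M) \<and> (\<forall>p. p \<notin> Props \<longrightarrow> val M p = {})"

definition pointed_models :: "'p set \<Rightarrow> ('w, 'p) pointed set" where
  "pointed_models Props = {(M, w). kripke_model Props M \<and> w \<in> worlds M}"

definition homomorphism ::
  "'p set \<Rightarrow> ('v \<Rightarrow> 'w) \<Rightarrow> ('v, 'p) pointed \<Rightarrow> ('w, 'p) pointed \<Rightarrow> bool" where
  "homomorphism Props f = (\<lambda>(M, w) (N, v).
     f ` worlds M \<subseteq> worlds N \<and> f w = v \<and>
     (\<forall>u\<in>worlds M. \<forall>z\<in>worlds M. (u, z) \<in> acc M \<longrightarrow> (f u, f z) \<in> acc N) \<and>
     (\<forall>u\<in>worlds M. \<forall>p\<in>Props. u \<in> val M p \<longrightarrow> f u \<in> val N p))"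

definition injective_homomorphism ::
  "'p set \<Rightarrow> ('v \<Rightarrow> 'w) \<Rightarrow> ('v, 'p) pointed \<Rightarrow> ('w, 'p) pointed \<Rightarrow> bool" where
  "injective_homomorphism Props f P Q \<longleftrightarrow> homomorphism Props f P Q \<and> inj_on f (worlds (fst P))"

definition isomorphic :: "'p set \<Rightarrow> ('v, 'p) pointed \<Rightarrow> ('w, 'p) pointed \<Rightarrow> bool" where
  "isomorphic Props = (\<lambda>(M, w) (N, v). \<exists>f.
     bij_betw f (worlds M) (worlds N) \<and> f w = v \<and>
     (\<forall>u\<in>worlds M. \<forall>z\<in>worlds M. (u, z) \<in> acc M \<longleftrightarrow> (f u, f z) \<in> acc N) \<and>
     (\<forall>u\<in>worlds M. \<forall>p\<in>Props. u \<in> val M p \<longleftrightarrow> f u \<in> val N p))"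

definition iso_closed :: "'p set \<Rightarrow> ('w, 'p) pointed set \<Rightarrow> bool" where
  "iso_closed Props C \<longleftrightarrow>
     (\<forall>P\<in>C. \<forall>Q\<in>pointed_models Props. isomorphic Props P Q \<longrightarrow> Q \<in> C)"

text \<open>An isomorphism-closed class of finite pointed models is represented by its members with worlds
  in an infinite type \<open>'w\<close>, which contains a copy of every finite model. A model over
  another type of worlds (such as an unravelling, whose worlds are lists) belongs to the class iff
  it has an isomorphic copy in this set.\<close>

definition belongs :: "'p set \<Rightarrow> ('v, 'p) pointed \<Rightarrow> ('w, 'p) pointed set \<Rightarrow> bool" where
  "belongs Props P C \<longleftrightarrow> (\<exists>Q\<in>C. isomorphic Props P Q)"

lemma belongs_iff_mem:
  assumes "iso_closed Props C" "C \<subseteq> pointed_models Props" "P \<in> pointed_models Props"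
  shows "belongs Props P C \<longleftrightarrow> P \<in> C"
proof
  assume "belongs Props P C"
  then obtain N v f where Q: "(N, v) \<in> C"
    and f: "bij_betw f (worlds (fst P)) (worlds N)" "f (snd P) = v"
      "\<forall>u\<in>worlds (fst P). \<forall>z\<in>worlds (fst P). (u, z) \<in> acc (fst P) \<longleftrightarrow> (f u, f z) \<in> acc N"
      "\<forall>u\<in>worlds (fst P). \<forall>p\<in>Props. u \<in> val (fst P) p \<longleftrightarrow> f u \<in> val N p"
    by (auto simp: belongs_def isomorphic_def split: prod.splits)
  define g where "g = the_inv_into (worlds (fst P)) f"
  have g: "bij_betw g (worlds N) (worlds (fst P))"
    unfolding g_def using f(1) by (rule bij_betw_the_inv_into)
  have fg: "f (g x) = x" "g x \<in> worlds (fst P)" if "x \<in> worlds N" for x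
    using that f(1) g by (auto simp: g_def bij_betw_def f_the_inv_into_f)
  have "g v = snd P"
    using f(1,2) assms(3)
    by (auto simp: g_def bij_betw_def pointed_models_def the_inv_into_f_f)
  then have "isomorphic Props (N, v) P"
    using g fg f(3,4) by (auto simp: isomorphic_def split: prod.splits intro!: exI[of _ g])
  then show "P \<in> C"
    using assms Q by (auto simp: iso_closed_def)
next
  assume "P \<in> C"
  then show "belongs Props P C"
    by (auto simp: belongs_def isomorphic_def split: prod.splits intro!: bexI[of _ P] exI[of _ id])
qed

definition preserved_inj_hom :: "'p set \<Rightarrow> ('w, 'p) pointed set \<Rightarrow> bool" where
  "preserved_inj_hom Props C \<longleftrightarrow>
     (\<forall>P\<in>C. \<forall>Q\<in>pointed_models Props. (\<exists>f. injective_homomorphism Props f P Q) \<longrightarrow> Q \<in> C)"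

definition unr_worlds :: "nat \<Rightarrow> ('w, 'p) pointed \<Rightarrow> 'w list set" where
  "unr_worlds L = (\<lambda>(M, w).
     {xs. xs \<noteq> [] \<and> hd xs = w \<and> length xs \<le> L + 1 \<and> successively (\<lambda>u v. (u, v) \<in> acc M) xs})"

definition unravelling :: "nat \<Rightarrow> ('w, 'p) pointed \<Rightarrow> ('w list, 'p) pointed" where
  "unravelling L P =
     (\<lparr>worlds = unr_worlds L P,
       acc = {(xs, ys). xs \<in> unr_worlds L P \<and> ys \<in> unr_worlds L P \<and> (\<exists>v. ys = xs @ [v])},
       val = (\<lambda>p. {xs \<in> unr_worlds L P. last xs \<in> val (fst P) p})\<rparr>,
      [snd P])"

lemma unravelling_pointed_model:
  assumes "P \<in> pointed_models Props"
  shows "unravelling L P \<in> pointed_models Props"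
proof -
  obtain M w where P: "P = (M, w)" by force
  have M: "finite (worlds M)" "acc M \<subseteq> worlds M \<times> worlds M" "w \<in> worlds M"
    "\<And>p. p \<notin> Props \<Longrightarrow> val M p = {}"
    using assms by (auto simp: P pointed_models_def kripke_model_def)
  have sub: "set xs \<subseteq> worlds M"
    if "successively (\<lambda>u v. (u, v) \<in> acc M) xs" "xs \<noteq> []" "hd xs \<in> worlds M" for xs
    using that M(2)
    by (induction xs rule: induct_list012) auto
  have "unr_worlds L P \<subseteq> {xs. set xs \<subseteq> worlds M \<and> length xs \<le> L + 1}"
    using sub M(3) by (auto simp: P unr_worlds_def)
  then have "finite (unr_worlds L P)"
    using finite_lists_length_le[OF M(1)] finite_subset by blast
  moreover have "[w] \<in> unr_worlds L P"
    by (auto simp: P unr_worlds_def)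
  ultimately show ?thesis
    using M(4) by (auto simp: P unravelling_def pointed_models_def kripke_model_def)
qed

definition unravelling_invariant :: "'p set \<Rightarrow> nat \<Rightarrow> ('w, 'p) pointed set \<Rightarrow> bool" where
  "unravelling_invariant Props L C \<longleftrightarrow>
     (\<forall>P\<in>pointed_models Props. P \<in> C \<longleftrightarrow> belongs Props (unravelling L P) C)"

text \<open>The constants \<open>Top\<close> and \<open>Bot\<close> (empty conjunction and disjunction) are needed as primitives:
  they are not expressible by formulas built from symbols, conjunction, disjunction and graded
  diamonds alone, while the class of all models and the empty class are preserved under injective
  homomorphisms and invariant under unravelling.\<close>

datatype 'p gml =
    Top
  | Bot
  | Prop 'p
  | Neg "'p gml"
  | Conj "'p gml" "'p gml"
  | Disj "'p gml" "'p gml"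
  | Dia nat "'p gml"

primrec gml_formula :: "'p set \<Rightarrow> 'p gml \<Rightarrow> bool" where
  "gml_formula Props Top \<longleftrightarrow> True"
| "gml_formula Props Bot \<longleftrightarrow> True"
| "gml_formula Props (Prop p) \<longleftrightarrow> p \<in> Props"
| "gml_formula Props (Neg \<phi>) \<longleftrightarrow> gml_formula Props \<phi>"
| "gml_formula Props (Conj \<phi> \<psi>) \<longleftrightarrow> gml_formula Props \<phi> \<and> gml_formula Props \<psi>"
| "gml_formula Props (Disj \<phi> \<psi>) \<longleftrightarrow> gml_formula Props \<phi> \<and> gml_formula Props \<psi>"
| "gml_formula Props (Dia k \<phi>) \<longleftrightarrow> k \<ge> 1 \<and> gml_formula Props \<phi>"

primrec negation_free :: "'p gml \<Rightarrow> bool" where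
  "negation_free Top \<longleftrightarrow> True"
| "negation_free Bot \<longleftrightarrow> True"
| "negation_free (Prop p) \<longleftrightarrow> True"
| "negation_free (Neg \<phi>) \<longleftrightarrow> False"
| "negation_free (Conj \<phi> \<psi>) \<longleftrightarrow> negation_free \<phi> \<and> negation_free \<psi>"
| "negation_free (Disj \<phi> \<psi>) \<longleftrightarrow> negation_free \<phi> \<and> negation_free \<psi>"
| "negation_free (Dia k \<phi>) \<longleftrightarrow> negation_free \<phi>"

primrec modal_depth :: "'p gml \<Rightarrow> nat" where
  "modal_depth Top = 0"
| "modal_depth Bot = 0"
| "modal_depth (Prop p) = 0"
| "modal_depth (Neg \<phi>) = modal_depth \<phi>"
| "modal_depth (Conj \<phi> \<psi>) = max (modal_depth \<phi>) (modal_depth \<psi>)"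
| "modal_depth (Disj \<phi> \<psi>) = max (modal_depth \<phi>) (modal_depth \<psi>)"
| "modal_depth (Dia k \<phi>) = modal_depth \<phi> + 1"

primrec sat :: "('w, 'p) kripke \<Rightarrow> 'w \<Rightarrow> 'p gml \<Rightarrow> bool" where
  "sat M w Top \<longleftrightarrow> True"
| "sat M w Bot \<longleftrightarrow> False"
| "sat M w (Prop p) \<longleftrightarrow> w \<in> val M p"
| "sat M w (Neg \<phi>) \<longleftrightarrow> \<not> sat M w \<phi>"
| "sat M w (Conj \<phi> \<psi>) \<longleftrightarrow> sat M w \<phi> \<and> sat M w \<psi>"
| "sat M w (Disj \<phi> \<psi>) \<longleftrightarrow> sat M w \<phi> \<or> sat M w \<psi>"
| "sat M w (Dia k \<phi>) \<longleftrightarrow> k \<le> card {u \<in> worlds M. (w, u) \<in> acc M \<and> sat M u \<phi>}"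

definition epgml :: "'p set \<Rightarrow> 'p gml set" where
  "epgml Props = {\<phi>. gml_formula Props \<phi> \<and> negation_free \<phi>}"

definition definable_by :: "'p set \<Rightarrow> ('w, 'p) pointed set \<Rightarrow> 'p gml \<Rightarrow> bool" where
  "definable_by Props C \<phi> \<longleftrightarrow>
     (\<forall>(M, w)\<in>pointed_models Props. sat M w \<phi> \<longleftrightarrow> (M, w) \<in> C)"

end

theory Submission
  imports Defs "HOL-Library.Ramsey"
begin

text \<open>
  Write \<open>P \<le>\<^sub>n Q\<close> if every symbol true at the point of \<open>P\<close> is true at the point of \<open>Q\<close> and, for
  \<open>n > 0\<close>, the successors of \<open>P\<close> can be matched injectively with successors of \<open>Q\<close> that are above
  them in \<open>\<le>\<^sub>n\<^sub>-\<^sub>1\<close>. Then \<open>P \<le>\<^sub>L Q\<close> yields an injective homomorphism between the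
  \<open>L\<close>-unravellings, so a class as in (1) is upwards closed under \<open>\<le>\<^sub>L\<close>. By Higman's lemma,
  applied once per level, \<open>\<le>\<^sub>L\<close> has no infinite bad sequence, hence such a class is generated by
  finitely many models. By Hall's theorem, the upward closure of a single model is defined by a
  negation-free formula of depth \<open>L\<close>; the defining formula is the disjunction over the generators.
\<close>

section \<open>Almost-full relations\<close>

text \<open>The lifting of a relation to sets by an injective choice of larger elements. Two element
  types are allowed so that models over different types of worlds can be compared.\<close>

definition set_emb :: "('a \<Rightarrow> 'b \<Rightarrow> bool) \<Rightarrow> 'a set \<Rightarrow> 'b set \<Rightarrow> bool" where
  "set_emb R X Y \<longleftrightarrow> (\<exists>f. inj_on f X \<and> f ` X \<subseteq> Y \<and> (\<forall>x\<in>X. R x (f x)))"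

text \<open>The sequence form of well-quasi-ordering: every infinite sequence in \<open>A\<close> is
  good.\<close>

definition almost_full_on :: "('a \<Rightarrow> 'a \<Rightarrow> bool) \<Rightarrow> 'a set \<Rightarrow> bool" where
  "almost_full_on R A \<longleftrightarrow>
     (\<forall>s :: nat \<Rightarrow> 'a. (\<forall>i. s i \<in> A) \<longrightarrow> (\<exists>i j. i < j \<and> R (s i) (s j)))"

text \<open>By Ramsey's theorem some infinite index set is homogeneous for the colouring of pairs by
  whether \<open>R\<close> holds in index order. The negative colour is excluded, since its
  enumeration would be a bad sequence.\<close>

lemma almost_full_on_subsequence:
  fixes s :: "nat \<Rightarrow> 'a"
  assumes "almost_full_on R A" "\<And>i. s i \<in> A"
  obtains g :: "nat \<Rightarrow> nat" where "strict_mono g" "\<And>i j. i < j \<Longrightarrow> R (s (g i)) (s (g j))"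
proof -
  \<comment> \<open>\<open>Min\<close> and \<open>Max\<close> recover the order of the two indices
    from the unordered pair.\<close>
  define c :: "nat set \<Rightarrow> nat" where "c = (\<lambda>e. if R (s (Min e)) (s (Max e)) then 1 else 0)"
  have "\<exists>Y t. Y \<subseteq> UNIV \<and> infinite Y \<and> t < 2 \<and> (\<forall>x\<in>Y. \<forall>y\<in>Y. x \<noteq> y \<longrightarrow> c {x, y} = t)"
    by (rule Ramsey2) (auto simp: c_def)
  then obtain Y t where Y: "infinite Y" "\<And>x y. x \<in> Y \<Longrightarrow> y \<in> Y \<Longrightarrow> x \<noteq> y \<Longrightarrow> c {x, y} = t"
    by metis
  define g where "g = enumerate Y"
  have g: "strict_mono g" "\<And>i. g i \<in> Y"
    using Y(1) by (auto simp: g_def strict_mono_enumerate enumerate_in_set)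
  have c: "c {g i, g j} = (if R (s (g i)) (s (g j)) then 1 else 0)" "c {g i, g j} = t" if "i < j" for i j
  proof -
    have "g i < g j" using g(1) that by (simp add: strict_mono_def)
    then show "c {g i, g j} = (if R (s (g i)) (s (g j)) then 1 else 0)" "c {g i, g j} = t"
      using Y(2)[OF g(2) g(2), of i j] by (auto simp: c_def)
  qed
  obtain i j where "i < j" "R (s (g i)) (s (g j))"
    using assms(1)[unfolded almost_full_on_def, rule_format, of "\<lambda>i. s (g i)"] assms(2) by blast
  then have "t = 1" using c by metis
  then have "R (s (g i)) (s (g j))" if "i < j" for i j
    using c[OF that] by (metis zero_neq_one)
  with g(1) show thesis by (rule that)
qed

text \<open>If no finite \<open>F\<close> sufficed, one could keep choosing elements of
  \<open>S\<close> that lie above none of the earlier choices, which produces a bad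
  sequence.\<close>

lemma almost_full_on_finite_basis:
  assumes "almost_full_on R A" "S \<subseteq> A"
  shows "\<exists>F. finite F \<and> F \<subseteq> S \<and> (\<forall>x\<in>S. \<exists>y\<in>F. R y x)"
proof (rule ccontr)
  assume neg: "\<not> ?thesis"
  have "\<exists>x. x \<in> S \<and> (\<forall>y\<in>F. \<not> R y x)" if "finite F" "F \<subseteq> S" for F
    using neg[unfolded not_ex, rule_format, of F] that by auto
  then have "\<forall>F\<in>{F. finite F \<and> F \<subseteq> S}. \<exists>x. x \<in> S \<and> (\<forall>y\<in>F. \<not> R y x)" by simp
  from bchoice[OF this] obtain h
    where "\<forall>F\<in>{F. finite F \<and> F \<subseteq> S}. h F \<in> S \<and> (\<forall>y\<in>F. \<not> R y (h F))" ..
  then have h: "h F \<in> S \<and> (\<forall>y\<in>F. \<not> R y (h F))" if "finite F" "F \<subseteq> S" for F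
    using that by simp
  \<comment> \<open>\<open>G n\<close> collects the first \<open>n\<close> choices; the bad sequence
    is \<open>h (G 0), h (G 1), ...\<close>.\<close>
  define G where "G = rec_nat {} (\<lambda>_ F. insert (h F) F)"
  have G: "G 0 = {}" "\<And>n. G (Suc n) = insert (h (G n)) (G n)" by (simp_all add: G_def)
  have fin: "finite (G n) \<and> G n \<subseteq> S" for n
  proof (induction n)
    case (Suc n)
    then show ?case using h[of "G n"] by (simp add: G)
  qed (simp add: G)
  have hG: "h (G n) \<in> S \<and> (\<forall>y\<in>G n. \<not> R y (h (G n)))" for n
    using fin[of n] by (intro h) auto
  have mono: "m \<le> n \<Longrightarrow> G m \<subseteq> G n" for m n
    by (rule lift_Suc_mono_le[of G]) (auto simp: G)
  have "h (G i) \<in> G j" if "i < j" for i j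
    using mono[of "Suc i" j] that by (auto simp: G)
  then have "\<not> R (h (G i)) (h (G j))" if "i < j" for i j
    using hG[of j] that by blast
  moreover have "h (G i) \<in> A" for i
    using hG[of i] assms(2) by blast
  ultimately show False
    using assms(1)[unfolded almost_full_on_def, rule_format, of "\<lambda>i. h (G i)"] by blast
qed

section \<open>Minimal bad sequences and Higman's lemma\<close>

text \<open>The entries are minimised one position at a time, each among the bad sequences that
  share the prefix already fixed. The limit is bad because any two of its entries occur together in
  one of the sequences built on the way.\<close>

lemma minimal_bad_sequence:
  fixes s :: "nat \<Rightarrow> 'a" and size :: "'a \<Rightarrow> nat" and R :: "'a \<Rightarrow> 'a \<Rightarrow> bool" and A :: "'a set"
  defines "bad \<equiv> \<lambda>s. (\<forall>i. s i \<in> A) \<and> (\<forall>i j. i < j \<longrightarrow> \<not> R (s i) (s j))"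
  assumes "bad s"
  shows "\<exists>m. bad m \<and> (\<forall>i t. bad t \<longrightarrow> (\<forall>j<i. t j = m j) \<longrightarrow> size (m i) \<le> size (t i))"
proof -
  \<comment> \<open>\<open>Q i s t\<close>: \<open>t\<close> keeps the first \<open>i\<close>
    entries of \<open>s\<close> and has the least possible size at position
    \<open>i\<close>.\<close>
  define Q where "Q i s t \<longleftrightarrow> (\<forall>j<i. t j = s j) \<and>
    (\<forall>u. bad u \<longrightarrow> (\<forall>j<i. u j = s j) \<longrightarrow> size (t i) \<le> size (u i))" for i s t
  have "\<exists>t. bad t \<and> Q i s t" if "bad s" for i s
    using ex_has_least_nat[of "\<lambda>t. bad t \<and> (\<forall>j<i. t j = s j)" s "\<lambda>t. size (t i)"] that
    unfolding Q_def by blast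
  then obtain S where S: "\<And>n. bad (S n)" "\<And>n. Q n (S n) (S (Suc n))"
    using dependent_nat_choice[of "\<lambda>_. bad" Q] assms(2) by metis
  \<comment> \<open>Position \<open>i\<close> is optimised in passing from \<open>S i\<close> to
    \<open>S (Suc i)\<close> and never changes afterwards.\<close>
  define m where "m i = S (Suc i) i" for i
  have stable: "S (Suc j + k) j = m j" for j k
  proof (induction k)
    case (Suc k)
    then show ?case using S(2)[of "Suc j + k"] by (simp add: Q_def)
  qed (simp add: m_def)
  have S_eq: "S n j = m j" if "j < n" for j n
    using stable[of j "n - Suc j"] that by simp
  have "bad m"
    unfolding bad_def
  proof (intro conjI allI impI)
    fix i
    show "m i \<in> A" using S(1)[of "Suc i"] by (simp add: bad_def m_def)
  next
    fix i j :: nat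
    assume "i < j"
    then show "\<not> R (m i) (m j)"
      using S(1)[of "Suc j"] S_eq[of i "Suc j"] S_eq[of j "Suc j"] unfolding bad_def
      by (metis less_SucI lessI)
  qed
  moreover have "size (m i) \<le> size (t i)" if "bad t" "\<forall>j<i. t j = m j" for i t
    using S(2)[of i] that S_eq[of _ i] by (simp add: Q_def m_def)
  ultimately show ?thesis by blast
qed

text \<open>Higman's lemma for finite sets, by Nash-Williams' minimal bad sequence argument.\<close>

lemma almost_full_on_set_emb:
  assumes "almost_full_on R A"
  shows "almost_full_on (set_emb R) {X. finite X \<and> X \<subseteq> A}"
proof (rule ccontr)
  define bad where "bad = (\<lambda>s :: nat \<Rightarrow> _. (\<forall>i. s i \<in> {X. finite X \<and> X \<subseteq> A}) \<and>
    (\<forall>i j. i < j \<longrightarrow> \<not> set_emb R (s i) (s j)))"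
  assume "\<not> ?thesis"
  then obtain s where "bad s"
    unfolding almost_full_on_def bad_def by auto
  then have "\<exists>m. bad m \<and> (\<forall>i t. bad t \<longrightarrow> (\<forall>j<i. t j = m j) \<longrightarrow> card (m i) \<le> card (t i))"
    unfolding bad_def by (rule minimal_bad_sequence)
  then obtain m where m: "bad m"
    and least: "\<forall>i t. bad t \<longrightarrow> (\<forall>j<i. t j = m j) \<longrightarrow> card (m i) \<le> card (t i)"
    by (elim exE conjE)
  have mA: "finite (m i)" "m i \<subseteq> A" for i
    using m by (auto simp: bad_def)
  have m_bad: "\<not> set_emb R (m i) (m j)" if "i < j" for i j
    using m that by (simp add: bad_def)
  \<comment> \<open>The empty set embeds into every set, so a bad sequence cannot contain
    it.\<close>
  have "m i \<noteq> {}" for i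
    using m_bad[of i "Suc i"] by (auto simp: set_emb_def)
  then have "\<forall>i. \<exists>x. x \<in> m i" by blast
  from choice[OF this] obtain x where x: "\<And>i. x i \<in> m i" by blast
  obtain g :: "nat \<Rightarrow> nat" where g: "strict_mono g" "\<And>i j. i < j \<Longrightarrow> R (x (g i)) (x (g j))"
    using almost_full_on_subsequence[OF assms, of x] x mA by (metis subsetD)
  define Y where "Y i = m i - {x i}" for i
  \<comment> \<open>\<open>t\<close> follows \<open>m\<close> up to the first index of the
    subsequence, then runs through the sets of the subsequence without their picked elements. If
    \<open>t\<close> is bad, its smaller set at position \<open>g 0\<close> contradicts minimality
    of \<open>m\<close>.\<close>
  define t where "t i = (if i < g 0 then m i else Y (g (i - g 0)))" for i
  have "\<not> set_emb R (t i) (t j)" if "i < j" for i j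
  proof
    assume emb: "set_emb R (t i) (t j)"
    consider "j < g 0" | "i < g 0" "g 0 \<le> j" | "g 0 \<le> i" using that by linarith
    then show False
    proof cases
      case 1
      then show ?thesis using emb m_bad that by (simp add: t_def)
    next
      \<comment> \<open>An embedding into \<open>Y (g (j - g 0))\<close> is also one into the larger
        set \<open>m (g (j - g 0))\<close>, whose index still exceeds \<open>i\<close>.\<close>
      case 2
      have "g 0 \<le> g (j - g 0)" using g(1) by (simp add: strict_mono_less_eq)
      moreover have "set_emb R (m i) (m (g (j - g 0)))"
        using emb 2 by (auto simp: t_def Y_def set_emb_def)
      ultimately show ?thesis using m_bad 2 by simp
    next
      \<comment> \<open>Both sets have lost their picked elements, and these are related; sending
        \<open>x a\<close> to \<open>x b\<close> extends the embedding to one of \<open>m a\<close>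
        into \<open>m b\<close>.\<close>
      case 3
      then have "\<not> j < g 0" using that by simp
      define a b where "a = g (i - g 0)" and "b = g (j - g 0)"
      have ab: "a < b" "R (x a) (x b)"
        using g 3 that by (auto simp: a_def b_def strict_mono_less diff_less_mono)
      obtain f where f: "inj_on f (Y a)" "f ` Y a \<subseteq> Y b" "\<forall>z\<in>Y a. R z (f z)"
        using emb 3 \<open>\<not> j < g 0\<close> by (auto simp: t_def a_def b_def set_emb_def)
      have ma: "m a = insert (x a) (Y a)" "m b = insert (x b) (Y b)" "x a \<notin> Y a" "x b \<notin> Y b"
        using x by (auto simp: Y_def)
      have upd: "(f(x a := x b)) ` Y a = f ` Y a"
        using ma(3) by (intro image_cong) auto
      have "inj_on (f(x a := x b)) (Y a)"
        using f(1) ma(3) by (subst inj_on_cong[of _ _ f]) auto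
      moreover have "x b \<notin> f ` Y a" using f(2) ma(4) by blast
      ultimately have "inj_on (f(x a := x b)) (m a)"
        using ma(3) upd by (simp add: ma(1))
      moreover have "(f(x a := x b)) ` m a \<subseteq> m b"
        using f(2) upd unfolding ma(1,2) by auto
      moreover have "\<forall>z\<in>m a. R z ((f(x a := x b)) z)"
        using f(3) ab by (auto simp: Y_def)
      ultimately have "set_emb R (m a) (m b)" unfolding set_emb_def by blast
      then show ?thesis using m_bad ab by blast
    qed
  qed
  moreover have "finite (t i) \<and> t i \<subseteq> A" for i
    using mA[of i] mA[of "g (i - g 0)"] by (auto simp: t_def Y_def)
  ultimately have "bad t" unfolding bad_def by blast
  moreover have "\<forall>j<g 0. t j = m j" by (simp add: t_def)
  ultimately have "card (m (g 0)) \<le> card (t (g 0))" using least by blast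
  moreover have "card (t (g 0)) < card (m (g 0))"
    using card_Diff1_less[OF mA(1) x, of "g 0"] by (simp add: t_def Y_def)
  ultimately show False by simp
qed

section \<open>Hall's theorem\<close>

text \<open>Induction on the size of \<open>A\<close>, with a case split on whether some proper
  nonempty subset is critical, that is, has exactly as many neighbours as elements.\<close>

theorem hall:
  fixes B :: "'a \<Rightarrow> 'b set"
  assumes "finite A" "\<And>x. x \<in> A \<Longrightarrow> finite (B x)"
    and "\<And>S. S \<subseteq> A \<Longrightarrow> card S \<le> card (\<Union>x\<in>S. B x)"
  shows "\<exists>f. inj_on f A \<and> (\<forall>x\<in>A. f x \<in> B x)"
  using assms
proof (induction "card A" arbitrary: A B rule: less_induct)
  case less
  show ?case
  proof (cases "\<exists>T. T \<subset> A \<and> T \<noteq> {} \<and> card (\<Union>x\<in>T. B x) = card T")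
    case True
    text \<open>A critical set \<open>T\<close> is matched separately; its neighbours are removed from the rest.\<close>
    then obtain T where T: "T \<subset> A" "T \<noteq> {}" "card (\<Union>x\<in>T. B x) = card T" by blast
    define U where "U = (\<Union>x\<in>T. B x)"
    have finT: "finite T" "finite U"
      using T less.prems(1,2) by (auto simp: U_def dest: finite_subset)
    have "card T < card A" using T less.prems(1) by (simp add: psubset_card_mono)
    then obtain f where f: "inj_on f T" "\<forall>x\<in>T. f x \<in> B x"
      using less.hyps[of T B] less.prems(2,3) T(1) finT(1) by (auto simp: psubset_eq subset_iff)
    have "card (A - T) < card A"
      using T less.prems(1) by (intro psubset_card_mono) auto
    \<comment> \<open>Hall's condition for \<open>S \<union> T\<close>, minus the
      \<open>card T\<close> neighbours in \<open>U\<close>, is the condition for \<open>S\<close> in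
      the reduced problem.\<close>
    moreover have "card S \<le> card (\<Union>x\<in>S. B x - U)" if "S \<subseteq> A - T" for S
    proof -
      have fS: "finite S" "finite (\<Union>x\<in>S. B x - U)"
        using that less.prems(1,2) finite_subset[OF that] by auto
      have "card S + card T = card (S \<union> T)"
        using that fS finT by (subst card_Un_disjoint) auto
      also have "\<dots> \<le> card (\<Union>x\<in>S \<union> T. B x)"
        using that T by (intro less.prems(3)) auto
      also have "(\<Union>x\<in>S \<union> T. B x) = (\<Union>x\<in>S. B x - U) \<union> U"
        by (auto simp: U_def)
      also have "card \<dots> = card (\<Union>x\<in>S. B x - U) + card U"
        using fS finT by (intro card_Un_disjoint) auto
      finally show ?thesis using T(3) by (simp add: U_def)
    qed
    ultimately obtain g where g: "inj_on g (A - T)" "\<forall>x\<in>A - T. g x \<in> B x - U"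
      using less.hyps[of "A - T" "\<lambda>x. B x - U"] less.prems(1,2) by auto
    define h where "h x = (if x \<in> T then f x else g x)" for x
    have "f x \<in> U" if "x \<in> T" for x using f that by (auto simp: U_def)
    then have "inj_on h A"
      using f(1) g unfolding inj_on_def h_def by (metis DiffD2 DiffI)
    moreover have "\<forall>x\<in>A. h x \<in> B x" using f g by (auto simp: h_def)
    ultimately show ?thesis by blast
  next
    case False
    show ?thesis
    proof (cases "A = {}")
      \<comment> \<open>Without critical sets any \<open>a\<close> may be matched with any
        \<open>b\<close> in \<open>B a\<close>: each remaining nonempty \<open>S\<close> has a spare
        neighbour, so it can afford to lose \<open>b\<close>.\<close>
      case False
      then obtain a where a: "a \<in> A" by blast
      have "B a \<noteq> {}" using less.prems(3)[of "{a}"] a by auto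
      then obtain b where b: "b \<in> B a" by blast
      have "card S \<le> card (\<Union>x\<in>S. B x - {b})" if S: "S \<subseteq> A - {a}" for S
      proof (cases "S = {}")
        case False
        have fin: "finite (\<Union>x\<in>S. B x)"
          using S less.prems(1,2) finite_subset[OF S] by auto
        have "S \<subset> A" using S a by blast
        then have "card (\<Union>x\<in>S. B x) \<noteq> card S"
          using False \<open>\<not> (\<exists>T. T \<subset> A \<and> T \<noteq> {} \<and> card (\<Union>x\<in>T. B x) = card T)\<close> by blast
        moreover have "card S \<le> card (\<Union>x\<in>S. B x)" using less.prems(3)[of S] S by blast
        ultimately have "card S \<le> card (\<Union>x\<in>S. B x) - 1" by simp
        also have "\<dots> \<le> card ((\<Union>x\<in>S. B x) - {b})" by (simp add: card_Diff_singleton_if)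
        also have "(\<Union>x\<in>S. B x) - {b} = (\<Union>x\<in>S. B x - {b})" by blast
        finally show ?thesis .
      qed simp
      moreover have "card (A - {a}) < card A" using a less.prems(1) by (intro card_Diff1_less)
      ultimately obtain g where g: "inj_on g (A - {a})" "\<forall>x\<in>A - {a}. g x \<in> B x - {b}"
        using less.hyps[of "A - {a}" "\<lambda>x. B x - {b}"] less.prems(1,2) by auto
      have "inj_on (g(a := b)) A" using g by (auto simp: inj_on_def)
      moreover have "\<forall>x\<in>A. (g(a := b)) x \<in> B x" using g b by auto
      ultimately show ?thesis by blast
    qed simp
  qed
qed

text \<open>Hall's theorem turns the existence of a matching into counting conditions, which graded
  diamonds can express.\<close>

lemma set_emb_iff_hall:
  assumes "finite X" "finite Y"
  shows "set_emb R X Y \<longleftrightarrow> (\<forall>S. S \<subseteq> X \<longrightarrow> card S \<le> card {y \<in> Y. \<exists>x\<in>S. R x y})"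
proof
  assume "set_emb R X Y"
  then obtain f where f: "inj_on f X" "f ` X \<subseteq> Y" "\<forall>x\<in>X. R x (f x)"
    by (auto simp: set_emb_def)
  show "\<forall>S. S \<subseteq> X \<longrightarrow> card S \<le> card {y \<in> Y. \<exists>x\<in>S. R x y}"
  proof (intro allI impI)
    fix S assume "S \<subseteq> X"
    then show "card S \<le> card {y \<in> Y. \<exists>x\<in>S. R x y}"
      using f assms by (intro card_inj_on_le[of f]) (auto intro: inj_on_subset)
  qed
next
  assume le: "\<forall>S. S \<subseteq> X \<longrightarrow> card S \<le> card {y \<in> Y. \<exists>x\<in>S. R x y}"
  have "(\<Union>x\<in>S. {y \<in> Y. R x y}) = {y \<in> Y. \<exists>x\<in>S. R x y}" for S by blast
  then have "\<exists>f. inj_on f X \<and> (\<forall>x\<in>X. f x \<in> {y \<in> Y. R x y})"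
    using le assms by (intro hall) auto
  then show "set_emb R X Y" by (auto simp: set_emb_def)
qed

section \<open>Bounded injective simulation\<close>

text \<open>One direction only: homomorphisms may make further symbols true, and negation-free
  formulas cannot detect falsity.\<close>

definition val_le :: "'p set \<Rightarrow> ('v, 'p) pointed \<Rightarrow> ('w, 'p) pointed \<Rightarrow> bool" where
  "val_le Props P Q \<longleftrightarrow> (\<forall>p\<in>Props. snd P \<in> val (fst P) p \<longrightarrow> snd Q \<in> val (fst Q) p)"

text \<open>Successors are kept as pointed models rather than worlds, so that relations between
  pointed models can be lifted to them by \<open>set_emb\<close>.\<close>

definition succs :: "('w, 'p) pointed \<Rightarrow> ('w, 'p) pointed set" where
  "succs P = Pair (fst P) ` {u \<in> worlds (fst P). (snd P, u) \<in> acc (fst P)}"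

text \<open>The depth-bounded simulation for graded modal logic without negation; injectivity on
  successors at every level is what preserves the counts.\<close>

primrec sim :: "'p set \<Rightarrow> nat \<Rightarrow> ('v, 'p) pointed \<Rightarrow> ('w, 'p) pointed \<Rightarrow> bool" where
  "sim Props 0 P Q \<longleftrightarrow> val_le Props P Q"
| "sim Props (Suc n) P Q \<longleftrightarrow> val_le Props P Q \<and> set_emb (sim Props n) (succs P) (succs Q)"

lemma succs_pointed_models:
  "P \<in> pointed_models Props \<Longrightarrow> finite (succs P) \<and> succs P \<subseteq> pointed_models Props"
  by (auto simp: succs_def pointed_models_def kripke_model_def) blast

text \<open>Finitely many symbols allow only finitely many labels, so infinitely many terms carry
  the same one.\<close>

lemma val_le_subsequence:
  fixes s :: "nat \<Rightarrow> ('w, 'p) pointed"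
  assumes "finite Props"
  obtains g :: "nat \<Rightarrow> nat" where "strict_mono g" "\<And>i j. val_le Props (s (g i)) (s (g j))"
proof -
  define l where "l i = {p \<in> Props. snd (s i) \<in> val (fst (s i)) p}" for i
  have "finite (range l)"
    by (rule finite_subset[of _ "Pow Props"]) (use assms in \<open>auto simp: l_def\<close>)
  then obtain k where k: "infinite {i. l i = l k}"
    using pigeonhole_infinite[of UNIV l] by auto
  define g where "g = enumerate {i. l i = l k}"
  have "l (g i) = l k" for i
    using enumerate_in_set[OF k, of i] by (simp add: g_def)
  then have "val_le Props (s (g i)) (s (g j))" for i j
    unfolding val_le_def l_def by blast
  moreover have "strict_mono g" using k by (simp add: g_def strict_mono_enumerate)
  ultimately show thesis using that by blast
qed

text \<open>Induction on depth: first pass to a subsequence with constant label, then apply Higman's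
  lemma to the finite sets of successors.\<close>

lemma almost_full_on_sim:
  assumes "finite Props"
  shows "almost_full_on (sim Props n) (pointed_models Props :: ('w, 'p) pointed set)"
proof (induction n)
  case 0
  show ?case
    unfolding almost_full_on_def
  proof (intro allI impI)
    fix s :: "nat \<Rightarrow> ('w, 'p) pointed"
    obtain g :: "nat \<Rightarrow> nat" where "strict_mono g" "\<And>i j. val_le Props (s (g i)) (s (g j))"
      using val_le_subsequence[OF assms, of s] by blast
    then show "\<exists>i j. i < j \<and> sim Props 0 (s i) (s j)"
      by (metis lessI sim.simps(1) strict_monoD)
  qed
next
  case (Suc n)
  show ?case
    unfolding almost_full_on_def
  proof (intro allI impI)
    fix s :: "nat \<Rightarrow> ('w, 'p) pointed"
    assume s: "\<forall>i. s i \<in> pointed_models Props"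
    obtain g :: "nat \<Rightarrow> nat" where g: "strict_mono g" "\<And>i j. val_le Props (s (g i)) (s (g j))"
      using val_le_subsequence[OF assms, of s] by blast
    have "succs (s (g i)) \<in> {X. finite X \<and> X \<subseteq> pointed_models Props}" for i
      using s succs_pointed_models by blast
    then obtain i j where "i < j" "set_emb (sim Props n) (succs (s (g i))) (succs (s (g j)))"
      using almost_full_on_set_emb[OF Suc, unfolded almost_full_on_def, rule_format,
          of "\<lambda>i. succs (s (g i))"] by blast
    then show "\<exists>i j. i < j \<and> sim Props (Suc n) (s i) (s j)"
      using g by (metis sim.simps(2) strict_monoD)
  qed
qed

section \<open>Negation-free formulas that characterise simulation\<close>

lemma epgml_big_conj:
  assumes "finite F" "F \<subseteq> {\<phi> \<in> epgml Props. modal_depth \<phi> \<le> n}"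
  shows "\<exists>\<psi>\<in>epgml Props. modal_depth \<psi> \<le> n \<and> (\<forall>(M :: ('w, 'p) kripke) w. sat M w \<psi> \<longleftrightarrow> (\<forall>\<phi>\<in>F. sat M w \<phi>))"
  using assms
proof (induction F rule: finite_induct)
  case empty
  show ?case by (rule bexI[of _ Top]) (auto simp: epgml_def)
next
  case (insert \<phi> F)
  then obtain \<psi> where "\<psi> \<in> epgml Props" "modal_depth \<psi> \<le> n"
    "\<forall>(M :: ('w, 'p) kripke) w. sat M w \<psi> \<longleftrightarrow> (\<forall>\<phi>\<in>F. sat M w \<phi>)" by auto
  with insert.prems show ?case by (intro bexI[of _ "Conj \<phi> \<psi>"]) (auto simp: epgml_def)
qed

text \<open>The case of no disjuncts, where \<open>Bot\<close> is used, arises for the empty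
  class.\<close>

lemma epgml_big_disj:
  assumes "finite F" "F \<subseteq> {\<phi> \<in> epgml Props. modal_depth \<phi> \<le> n}"
  shows "\<exists>\<psi>\<in>epgml Props. modal_depth \<psi> \<le> n \<and> (\<forall>(M :: ('w, 'p) kripke) w. sat M w \<psi> \<longleftrightarrow> (\<exists>\<phi>\<in>F. sat M w \<phi>))"
  using assms
proof (induction F rule: finite_induct)
  case empty
  show ?case by (rule bexI[of _ Bot]) (auto simp: epgml_def)
next
  case (insert \<phi> F)
  then obtain \<psi> where "\<psi> \<in> epgml Props" "modal_depth \<psi> \<le> n"
    "\<forall>(M :: ('w, 'p) kripke) w. sat M w \<psi> \<longleftrightarrow> (\<exists>\<phi>\<in>F. sat M w \<phi>)" by auto
  with insert.prems show ?case by (intro bexI[of _ "Disj \<phi> \<psi>"]) (auto simp: epgml_def)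
qed

lemma sat_Dia_succs:
  "sat (fst Q) (snd Q) (Dia k \<phi>) \<longleftrightarrow> k \<le> card {R \<in> succs Q. sat (fst R) (snd R) \<phi>}"
proof -
  have "{R \<in> succs Q. sat (fst R) (snd R) \<phi>} =
    Pair (fst Q) ` {u \<in> worlds (fst Q). (snd Q, u) \<in> acc (fst Q) \<and> sat (fst Q) u \<phi>}"
    by (auto simp: succs_def)
  then show ?thesis by (simp add: card_image inj_on_def)
qed

lemma epgml_val_le:
  assumes "finite Props"
  shows "\<exists>\<phi>\<in>epgml Props. modal_depth \<phi> \<le> n \<and>
    (\<forall>Q :: ('w, 'p) pointed. sat (fst Q) (snd Q) \<phi> \<longleftrightarrow> val_le Props P Q)"
proof -
  have "\<exists>\<psi>\<in>epgml Props. modal_depth \<psi> \<le> n \<and> (\<forall>(M :: ('w, 'p) kripke) w. sat M w \<psi> \<longleftrightarrow>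
    (\<forall>\<phi>\<in>Prop ` {p \<in> Props. snd P \<in> val (fst P) p}. sat M w \<phi>))"
    using assms by (intro epgml_big_conj) (auto simp: epgml_def)
  then show ?thesis by (simp add: val_le_def) blast
qed

text \<open>By Hall's condition, matching the successors injectively amounts to finitely many graded
  diamonds over disjunctions, one for each set of successors.\<close>

lemma epgml_sim:
  fixes P :: "('v, 'p) pointed"
  assumes "finite Props" "P \<in> pointed_models Props"
  shows "\<exists>\<phi>\<in>epgml Props. modal_depth \<phi> \<le> n \<and>
    (\<forall>Q\<in>pointed_models Props :: ('w, 'p) pointed set. sat (fst Q) (snd Q) \<phi> \<longleftrightarrow> sim Props n P Q)"
  using assms(2)
proof (induction n arbitrary: P)
  case 0
  show ?case using epgml_val_le[OF assms(1), of 0 P] by fastforce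
next
  case (Suc n)
  have P: "finite (succs P)" "succs P \<subseteq> pointed_models Props"
    using succs_pointed_models[OF Suc.prems] by auto
  \<comment> \<open>\<open>good \<psi> S\<close>: \<open>\<psi>\<close> has depth at most
    \<open>n\<close> and defines the models that simulate some member of \<open>S\<close>.\<close>
  define good :: "'p gml \<Rightarrow> ('v, 'p) pointed set \<Rightarrow> bool" where
    "good \<psi> S \<longleftrightarrow> \<psi> \<in> epgml Props \<and> modal_depth \<psi> \<le> n \<and>
      (\<forall>Q\<in>pointed_models Props :: ('w, 'p) pointed set.
         sat (fst Q) (snd Q) \<psi> \<longleftrightarrow> (\<exists>R\<in>S. sim Props n R Q))" for \<psi> S
  have "\<exists>\<psi>. good \<psi> S" if S: "S \<subseteq> succs P" for S
  proof -
    have "\<forall>R\<in>S. \<exists>\<phi>. \<phi> \<in> epgml Props \<and> modal_depth \<phi> \<le> n \<and>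
      (\<forall>Q\<in>pointed_models Props :: ('w, 'p) pointed set. sat (fst Q) (snd Q) \<phi> \<longleftrightarrow> sim Props n R Q)"
      using Suc.IH S P by blast
    then obtain c where c: "\<forall>R\<in>S. c R \<in> epgml Props \<and> modal_depth (c R) \<le> n \<and>
      (\<forall>Q\<in>pointed_models Props :: ('w, 'p) pointed set. sat (fst Q) (snd Q) (c R) \<longleftrightarrow> sim Props n R Q)"
      by (auto dest: bchoice)
    have "\<exists>\<psi>\<in>epgml Props. modal_depth \<psi> \<le> n \<and>
      (\<forall>(M :: ('w, 'p) kripke) w. sat M w \<psi> \<longleftrightarrow> (\<exists>\<phi>\<in>c ` S. sat M w \<phi>))"
      using c S P(1) by (intro epgml_big_disj) (auto dest: finite_subset)
    then obtain \<psi> where "\<psi> \<in> epgml Props" "modal_depth \<psi> \<le> n"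
      "\<forall>(M :: ('w, 'p) kripke) w. sat M w \<psi> \<longleftrightarrow> (\<exists>\<phi>\<in>c ` S. sat M w \<phi>)" by blast
    then have "good \<psi> S" using c by (simp add: good_def)
    then show ?thesis ..
  qed
  then obtain d where d: "\<And>S. S \<subseteq> succs P \<Longrightarrow> good (d S) S" by metis
  \<comment> \<open>One diamond for each instance of Hall's condition. The empty set is left out
    because a formula may not contain \<open>Dia 0\<close>; its instance is trivial and is added
    back below.\<close>
  define F where "F = (\<lambda>S. Dia (card S) (d S)) ` {S. S \<subseteq> succs P \<and> S \<noteq> {}}"
  obtain \<alpha> where \<alpha>: "\<alpha> \<in> epgml Props" "modal_depth \<alpha> \<le> Suc n"
    "\<forall>Q :: ('w, 'p) pointed. sat (fst Q) (snd Q) \<alpha> \<longleftrightarrow> val_le Props P Q"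
    using epgml_val_le[OF assms(1)] by blast
  have "F \<subseteq> {\<phi> \<in> epgml Props. modal_depth \<phi> \<le> Suc n}"
  proof
    fix \<phi> assume "\<phi> \<in> F"
    then obtain S where S: "S \<subseteq> succs P" "S \<noteq> {}" "\<phi> = Dia (card S) (d S)" by (auto simp: F_def)
    have "card S \<noteq> 0" using S P(1) finite_subset by fastforce
    with S d[OF S(1)] show "\<phi> \<in> {\<phi> \<in> epgml Props. modal_depth \<phi> \<le> Suc n}"
      by (simp add: good_def epgml_def)
  qed
  moreover have "finite F" using P(1) by (simp add: F_def)
  ultimately have "\<exists>\<psi>\<in>epgml Props. modal_depth \<psi> \<le> Suc n \<and>
    (\<forall>(M :: ('w, 'p) kripke) w. sat M w \<psi> \<longleftrightarrow> (\<forall>\<phi>\<in>insert \<alpha> F. sat M w \<phi>))"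
    using \<alpha> by (intro epgml_big_conj) auto
  then obtain \<psi> where \<psi>: "\<psi> \<in> epgml Props" "modal_depth \<psi> \<le> Suc n"
    "\<forall>(M :: ('w, 'p) kripke) w. sat M w \<psi> \<longleftrightarrow> (\<forall>\<phi>\<in>insert \<alpha> F. sat M w \<phi>)" by blast
  have "sat (fst Q) (snd Q) \<psi> \<longleftrightarrow> sim Props (Suc n) P Q"
    if Q: "Q \<in> pointed_models Props" for Q :: "('w, 'p) pointed"
  proof -
    have sQ: "finite (succs Q)" "succs Q \<subseteq> pointed_models Props"
      using succs_pointed_models[OF Q] by auto
    have dia: "sat (fst Q) (snd Q) (Dia (card S) (d S)) \<longleftrightarrow>
        card S \<le> card {R \<in> succs Q. \<exists>T\<in>S. sim Props n T R}" if "S \<subseteq> succs P" for S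
    proof -
      have "{R \<in> succs Q. sat (fst R) (snd R) (d S)} = {R \<in> succs Q. \<exists>T\<in>S. sim Props n T R}"
        using d[OF that] sQ(2) unfolding good_def by blast
      then show ?thesis unfolding sat_Dia_succs by simp
    qed
    have "(\<forall>\<phi>\<in>F. sat (fst Q) (snd Q) \<phi>) \<longleftrightarrow>
        (\<forall>S. S \<subseteq> succs P \<longrightarrow> S \<noteq> {} \<longrightarrow> sat (fst Q) (snd Q) (Dia (card S) (d S)))"
      unfolding F_def by blast
    also have "\<dots> \<longleftrightarrow> (\<forall>S. S \<subseteq> succs P \<longrightarrow> card S \<le> card {R \<in> succs Q. \<exists>T\<in>S. sim Props n T R})"
    proof (rule iff_allI)
      fix S
      show "(S \<subseteq> succs P \<longrightarrow> S \<noteq> {} \<longrightarrow> sat (fst Q) (snd Q) (Dia (card S) (d S))) \<longleftrightarrow>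
        (S \<subseteq> succs P \<longrightarrow> card S \<le> card {R \<in> succs Q. \<exists>T\<in>S. sim Props n T R})"
        using dia[of S] by (cases "S = {}") (simp_all del: sat.simps)
    qed
    also have "\<dots> \<longleftrightarrow> set_emb (sim Props n) (succs P) (succs Q)"
      using set_emb_iff_hall[OF P(1) sQ(1)] by blast
    finally show ?thesis using \<psi>(3) \<alpha>(3) by simp
  qed
  with \<psi>(1,2) show ?case by blast
qed

section \<open>Unravellings\<close>

lemma unr_worlds_0: "unr_worlds 0 P = {[snd P]}"
  by (cases P) (auto simp: unr_worlds_def le_Suc_eq length_Suc_conv)

lemma unr_worlds_Suc:
  assumes "acc (fst P) \<subseteq> worlds (fst P) \<times> worlds (fst P)"
  shows "unr_worlds (Suc n) P = insert [snd P] (\<Union>Q\<in>succs P. Cons (snd P) ` unr_worlds n Q)"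
proof (intro set_eqI)
  fix xs
  show "xs \<in> unr_worlds (Suc n) P \<longleftrightarrow>
    xs \<in> insert [snd P] (\<Union>Q\<in>succs P. Cons (snd P) ` unr_worlds n Q)"
    using assms
    by (cases P; cases xs rule: remdups_adj.cases)
      (auto simp: unr_worlds_def succs_def image_iff neq_Nil_conv)
qed


text \<open>An injective homomorphism of unravellings, phrased on paths so that it can be assembled
  recursively. \<open>xs \<noteq> []\<close> restricts the edge clause to real edges, since the
  empty list is not a world.\<close>

definition unr_emb ::
  "'p set \<Rightarrow> nat \<Rightarrow> ('v, 'p) pointed \<Rightarrow> ('w, 'p) pointed \<Rightarrow> ('v list \<Rightarrow> 'w list) \<Rightarrow> bool" where
  "unr_emb Props n P Q h \<longleftrightarrow>
    inj_on h (unr_worlds n P) \<and> h ` unr_worlds n P \<subseteq> unr_worlds n Q \<and> h [snd P] = [snd Q] \<and>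
    (\<forall>xs x. xs \<noteq> [] \<longrightarrow> xs @ [x] \<in> unr_worlds n P \<longrightarrow> (\<exists>y. h (xs @ [x]) = h xs @ [y])) \<and>
    (\<forall>xs\<in>unr_worlds n P. \<forall>p\<in>Props. last xs \<in> val (fst P) p \<longrightarrow> last (h xs) \<in> val (fst Q) p)"

text \<open>Root goes to root, and the subtree of each successor \<open>R\<close> goes into the
  subtree of its match \<open>f R\<close> by the induction hypothesis. Injectivity of
  \<open>f\<close> keeps the images of different subtrees apart.\<close>

lemma sim_unr_emb:
  assumes "P \<in> pointed_models Props" "Q \<in> pointed_models Props" "sim Props n P Q"
  shows "\<exists>h. unr_emb Props n P Q h"
  using assms
proof (induction n arbitrary: P Q)
  case 0
  then show ?case
    by (intro exI[of _ "\<lambda>_. [snd Q]"]) (auto simp: unr_emb_def unr_worlds_0 val_le_def)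
next
  case (Suc n)
  have sP: "succs P \<subseteq> pointed_models Props" and sQ: "succs Q \<subseteq> pointed_models Props"
    using Suc.prems succs_pointed_models by blast+
  have unrP: "unr_worlds (Suc n) P = insert [snd P] (\<Union>R\<in>succs P. Cons (snd P) ` unr_worlds n R)"
    and unrQ: "unr_worlds (Suc n) Q = insert [snd Q] (\<Union>R\<in>succs Q. Cons (snd Q) ` unr_worlds n R)"
    using Suc.prems by (auto intro!: unr_worlds_Suc simp: pointed_models_def kripke_model_def)
  have val: "val_le Props P Q" using Suc.prems(3) by simp
  obtain f where f: "inj_on f (succs P)" "f ` succs P \<subseteq> succs Q" "\<forall>R\<in>succs P. sim Props n R (f R)"
    using Suc.prems(3) by (auto simp: set_emb_def)
  have "\<forall>R\<in>succs P. \<exists>h. unr_emb Props n R (f R) h"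
    using Suc.IH f sP sQ by blast
  from bchoice[OF this] obtain H where H': "\<And>R. R \<in> succs P \<Longrightarrow> unr_emb Props n R (f R) (H R)"
    by blast
  note H = H'[unfolded unr_emb_def, THEN conjunct1]
    H'[unfolded unr_emb_def, THEN conjunct2, THEN conjunct1]
    H'[unfolded unr_emb_def, THEN conjunct2, THEN conjunct2, THEN conjunct1]
    H'[unfolded unr_emb_def, THEN conjunct2, THEN conjunct2, THEN conjunct2, THEN conjunct1, rule_format]
    H'[unfolded unr_emb_def, THEN conjunct2, THEN conjunct2, THEN conjunct2, THEN conjunct2, rule_format]
  \<comment> \<open>The second entry of a path, paired with the model of \<open>P\<close>,
    identifies the successor whose embedding is to be used.\<close>
  define h where "h xs = snd Q # (if tl xs = [] then [] else H (fst P, hd (tl xs)) (tl xs))" for xs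
  have h_root: "h [snd P] = [snd Q]" by (simp add: h_def)
  have R_eq: "(fst P, hd ys) = R" if "R \<in> succs P" "ys \<in> unr_worlds n R" for R ys
    using that by (cases R; cases P) (auto simp: succs_def unr_worlds_def)
  have h_Cons: "h (snd P # ys) = snd Q # H R ys" if "R \<in> succs P" "ys \<in> unr_worlds n R" for R ys
    using R_eq[OF that] that(2) by (cases R) (auto simp: h_def unr_worlds_def)
  have H_in: "H R ys \<in> unr_worlds n (f R) \<and> f R \<in> succs Q" if "R \<in> succs P" "ys \<in> unr_worlds n R" for R ys
    using H(2) f(2) that by blast
  have H_hd: "H R ys \<noteq> [] \<and> hd (H R ys) = snd (f R)" if "R \<in> succs P" "ys \<in> unr_worlds n R" for R ys
    using H_in[OF that] by (cases "f R") (auto simp: unr_worlds_def)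
  have "inj_on h (unr_worlds (Suc n) P)"
  proof (rule inj_onI)
    fix xs ys
    assume xs: "xs \<in> unr_worlds (Suc n) P" and ys: "ys \<in> unr_worlds (Suc n) P" and eq: "h xs = h ys"
    consider "xs = [snd P]" "ys = [snd P]"
      | R zs where "xs = [snd P]" "R \<in> succs P" "zs \<in> unr_worlds n R" "ys = snd P # zs"
      | R zs where "ys = [snd P]" "R \<in> succs P" "zs \<in> unr_worlds n R" "xs = snd P # zs"
      | R zs R' zs' where "R \<in> succs P" "zs \<in> unr_worlds n R" "xs = snd P # zs"
          "R' \<in> succs P" "zs' \<in> unr_worlds n R'" "ys = snd P # zs'"
      using xs ys unfolding unrP by blast
    then show "xs = ys"
    proof cases
      \<comment> \<open>The head of an image path is the world of \<open>f R\<close>; as all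
        successors of \<open>Q\<close> share one model, it determines \<open>f R\<close> and hence
        \<open>R\<close>.\<close>
      case (4 R zs R' zs')
      then have HH: "H R zs = H R' zs'" using eq h_Cons by simp
      then have "snd (f R) = snd (f R')" using H_hd 4 by metis
      moreover have "fst (f R) = fst Q" "fst (f R') = fst Q"
        using H_in[OF 4(1,2)] H_in[OF 4(4,5)] by (auto simp: succs_def)
      ultimately have "f R = f R'" by (simp add: prod_eq_iff)
      then have "R = R'" by (rule inj_onD[OF f(1) _ 4(1,4)])
      then show ?thesis using HH inj_onD[OF H(1)[OF 4(1)]] 4 by auto
    next
      case (2 R zs)
      then show ?thesis using eq h_root h_Cons[OF 2(2,3)] H_hd[OF 2(2,3)] by simp
    next
      case (3 R zs)
      then show ?thesis using eq h_root h_Cons[OF 3(2,3)] H_hd[OF 3(2,3)] by simp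
    qed simp
  qed
  moreover have "h ` unr_worlds (Suc n) P \<subseteq> unr_worlds (Suc n) Q"
  proof
    fix ys assume "ys \<in> h ` unr_worlds (Suc n) P"
    then consider "ys = h [snd P]"
      | R zs where "R \<in> succs P" "zs \<in> unr_worlds n R" "ys = h (snd P # zs)"
      unfolding unrP by blast
    then show "ys \<in> unr_worlds (Suc n) Q"
    proof cases
      case (2 R zs)
      then show ?thesis using h_Cons[OF 2(1,2)] H_in[OF 2(1,2)] unfolding unrQ by blast
    qed (simp add: h_root unrQ)
  qed
  moreover have "\<exists>y. h (xs @ [x]) = h xs @ [y]" if xs: "xs \<noteq> []" "xs @ [x] \<in> unr_worlds (Suc n) P" for xs x
  proof -
    obtain R zs where R: "R \<in> succs P" "zs \<in> unr_worlds n R" "xs @ [x] = snd P # zs"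
      using xs unfolding unrP by auto
    obtain ys where ys: "xs = snd P # ys" "zs = ys @ [x]"
      using R(3) xs(1) by (cases xs) auto
    show ?thesis
    proof (cases "ys = []")
      \<comment> \<open>Here the parent is the root of the whole tree, outside the subtree of
        \<open>R\<close>, so the edge clause for \<open>H R\<close> does not apply and the root
        clause takes its place.\<close>
      case True
      then have "zs = [snd R]" using R(2) ys by (cases R) (auto simp: unr_worlds_def)
      then show ?thesis using H(3) R ys True h_root h_Cons by auto
    next
      case False
      have "ys \<in> unr_worlds n R"
        using R(2) ys(2) False by (cases R) (auto simp: unr_worlds_def successively_append_iff)
      moreover obtain y where "H R (ys @ [x]) = H R ys @ [y]"
        using H(4) R(1,2) ys(2) False by blast
      ultimately show ?thesis using R ys h_Cons by auto
    qed
  qed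
  moreover have "last (h xs) \<in> val (fst Q) p"
    if xs: "xs \<in> unr_worlds (Suc n) P" "p \<in> Props" "last xs \<in> val (fst P) p" for xs p
  proof (cases "xs = [snd P]")
    case True
    then show ?thesis using xs val h_root by (simp add: val_le_def)
  next
    case False
    then obtain R zs where R: "R \<in> succs P" "zs \<in> unr_worlds n R" "xs = snd P # zs"
      using xs unfolding unrP by auto
    have "zs \<noteq> []" using R(2) by (cases R) (auto simp: unr_worlds_def)
    then have "last zs \<in> val (fst R) p" using xs(3) R by (auto simp: succs_def)
    then have "last (H R zs) \<in> val (fst (f R)) p" using H(5) R xs(2) by blast
    moreover have "fst (f R) = fst Q" using H_in[OF R(1,2)] by (auto simp: succs_def)
    ultimately show ?thesis using h_Cons H_hd R by simp
  qed
  ultimately show ?case unfolding unr_emb_def using h_root by blast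
qed

lemma sim_injective_homomorphism_unravelling:
  assumes "P \<in> pointed_models Props" "Q \<in> pointed_models Props" "sim Props n P Q"
  shows "\<exists>h. injective_homomorphism Props h (unravelling n P) (unravelling n Q)"
proof -
  obtain h where h: "unr_emb Props n P Q h"
    using sim_unr_emb[OF assms] by blast
  have "[] \<notin> unr_worlds n P" by (cases P) (simp add: unr_worlds_def)
  then have "\<exists>y. h (xs @ [x]) = h xs @ [y]" if "xs \<in> unr_worlds n P" "xs @ [x] \<in> unr_worlds n P" for xs x
    using h that unfolding unr_emb_def by metis
  then have "injective_homomorphism Props h (unravelling n P) (unravelling n Q)"
    using h unfolding injective_homomorphism_def homomorphism_def unravelling_def unr_emb_def by auto
  then show ?thesis by blast
qed

text \<open>A path of length \<open>length xs\<close> leaves \<open>L + 1 - length xs\<close>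
  further levels, enough for the modal depth of the formula. Within that budget the children of
  \<open>xs\<close> correspond one-to-one to the successors of \<open>last xs\<close>.\<close>

lemma sat_unravelling:
  assumes "acc (fst P) \<subseteq> worlds (fst P) \<times> worlds (fst P)"
    and "xs \<in> unr_worlds L P" "length xs + modal_depth \<phi> \<le> L + 1"
  shows "sat (fst (unravelling L P)) xs \<phi> \<longleftrightarrow> sat (fst P) (last xs) \<phi>"
  using assms(2,3)
proof (induction \<phi> arbitrary: xs)
  case (Dia k \<phi>)
  \<comment> \<open>The diamond contributes at least one to the depth, so \<open>xs\<close> has
    length at most \<open>L\<close> and can still be extended.\<close>
  have app: "xs @ [u] \<in> unr_worlds L P \<longleftrightarrow> (last xs, u) \<in> acc (fst P)" for u
    using Dia.prems by (cases P) (auto simp: unr_worlds_def successively_append_iff)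
  have "{ys \<in> worlds (fst (unravelling L P)). (xs, ys) \<in> acc (fst (unravelling L P)) \<and>
      sat (fst (unravelling L P)) ys \<phi>} =
    (\<lambda>u. xs @ [u]) ` {u \<in> worlds (fst P). (last xs, u) \<in> acc (fst P) \<and> sat (fst P) u \<phi>}"
    using Dia.prems Dia.IH app assms(1) by (auto simp: unravelling_def)
  then show ?case by (simp add: card_image inj_on_def)
qed (simp_all add: unravelling_def)

section \<open>Transfer between models\<close>

text \<open>Witnesses of a diamond are mapped to distinct witnesses, so their number does not drop.
  Finiteness of the target matters because \<open>card\<close> of an infinite set is 0.\<close>

lemma sat_injective_homomorphism:
  assumes hom: "injective_homomorphism Props f P Q"
    and "finite (worlds (fst Q))" "\<phi> \<in> epgml Props"
    and "u \<in> worlds (fst P)" "sat (fst P) u \<phi>"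
  shows "sat (fst Q) (f u) \<phi>"
  using assms(3-)
proof (induction \<phi> arbitrary: u)
  case (Prop p)
  then show ?case
    using hom by (auto simp: injective_homomorphism_def homomorphism_def epgml_def split: prod.splits)
next
  case (Dia k \<phi>)
  have f: "inj_on f (worlds (fst P))" "f ` worlds (fst P) \<subseteq> worlds (fst Q)"
    "\<And>x y. x \<in> worlds (fst P) \<Longrightarrow> y \<in> worlds (fst P) \<Longrightarrow> (x, y) \<in> acc (fst P) \<Longrightarrow> (f x, f y) \<in> acc (fst Q)"
    using hom by (auto simp: injective_homomorphism_def homomorphism_def split: prod.splits)
  have "card {v \<in> worlds (fst P). (u, v) \<in> acc (fst P) \<and> sat (fst P) v \<phi>}
    \<le> card {v \<in> worlds (fst Q). (f u, v) \<in> acc (fst Q) \<and> sat (fst Q) v \<phi>}"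
  proof (rule card_inj_on_le)
    show "inj_on f {v \<in> worlds (fst P). (u, v) \<in> acc (fst P) \<and> sat (fst P) v \<phi>}"
      using f(1) by (rule inj_on_subset) auto
    show "f ` {v \<in> worlds (fst P). (u, v) \<in> acc (fst P) \<and> sat (fst P) v \<phi>}
      \<subseteq> {v \<in> worlds (fst Q). (f u, v) \<in> acc (fst Q) \<and> sat (fst Q) v \<phi>}"
      using f Dia.IH Dia.prems by (auto simp: epgml_def)
  qed (use assms(2) in simp)
  with Dia.prems show ?case by simp
qed (auto simp: epgml_def)

lemma isomorphic_injective_homomorphism:
  assumes "isomorphic Props P Q"
  shows "\<exists>f. injective_homomorphism Props f P Q"
  using assms
  by (fastforce simp: isomorphic_def injective_homomorphism_def homomorphism_def bij_betw_def
      split: prod.splits)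

text \<open>\<open>belongs\<close> provides an isomorphism out of the unravelling, while composing
  homomorphisms also requires a map back into it.\<close>

lemma isomorphic_sym:
  assumes "isomorphic Props P Q" "P \<in> pointed_models Props"
  shows "isomorphic Props Q P"
proof -
  obtain f where f: "bij_betw f (worlds (fst P)) (worlds (fst Q))" "f (snd P) = snd Q"
    "\<forall>u\<in>worlds (fst P). \<forall>z\<in>worlds (fst P). (u, z) \<in> acc (fst P) \<longleftrightarrow> (f u, f z) \<in> acc (fst Q)"
    "\<forall>u\<in>worlds (fst P). \<forall>p\<in>Props. u \<in> val (fst P) p \<longleftrightarrow> f u \<in> val (fst Q) p"
    using assms(1) by (auto simp: isomorphic_def split: prod.splits)
  define g where "g = the_inv_into (worlds (fst P)) f"
  have g: "bij_betw g (worlds (fst Q)) (worlds (fst P))"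
    unfolding g_def using f(1) by (rule bij_betw_the_inv_into)
  have fg: "f (g x) = x" "g x \<in> worlds (fst P)" if "x \<in> worlds (fst Q)" for x
    using that f(1) g by (auto simp: g_def bij_betw_def f_the_inv_into_f)
  have "g (snd Q) = snd P"
    using f(1,2) assms(2) unfolding g_def bij_betw_def pointed_models_def
    by (auto intro: the_inv_into_f_eq)
  then show ?thesis
    using g fg f(3,4) by (auto simp: isomorphic_def split: prod.splits intro!: exI[of _ g])
qed

lemma injective_homomorphism_comp:
  assumes "injective_homomorphism Props f P Q" "injective_homomorphism Props g Q R"
  shows "injective_homomorphism Props (g \<circ> f) P R"
proof -
  have "inj_on (g \<circ> f) (worlds (fst P))"
    using assms by (intro comp_inj_on)
      (auto simp: injective_homomorphism_def homomorphism_def split: prod.splits intro: inj_on_subset)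
  with assms show ?thesis
    by (auto simp: injective_homomorphism_def homomorphism_def image_subset_iff split: prod.splits)
qed

text \<open>An infinite type has subsets of every finite size, along which the structure is
  transported. This brings unravellings, whose worlds are lists, back to the type of worlds of the
  class.\<close>

lemma ex_isomorphic_copy:
  fixes P :: "('v, 'p) pointed"
  assumes "infinite (UNIV :: 'w set)" "P \<in> pointed_models Props"
  shows "\<exists>Q\<in>pointed_models Props :: ('w, 'p) pointed set. isomorphic Props P Q"
proof -
  obtain M w where P: "P = (M, w)" by force
  have M: "finite (worlds M)" "worlds M \<noteq> {}" "acc M \<subseteq> worlds M \<times> worlds M"
    "\<And>p. p \<in> Props \<Longrightarrow> val M p \<subseteq> worlds M" "\<And>p. p \<notin> Props \<Longrightarrow> val M p = {}" "w \<in> worlds M"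
    using assms(2) by (auto simp: P pointed_models_def kripke_model_def)
  obtain B :: "'w set" where "finite B" "card B = card (worlds M)"
    using infinite_arbitrarily_large[OF assms(1)] by metis
  then obtain f where f: "bij_betw f (worlds M) B"
    using M(1) finite_same_card_bij by metis
  define N where "N = \<lparr>worlds = f ` worlds M, acc = map_prod f f ` acc M, val = (\<lambda>p. f ` val M p)\<rparr>"
  have inj: "inj_on f (worlds M)" using f by (simp add: bij_betw_def)
  have "(N, f w) \<in> pointed_models Props"
    using M by (auto simp: N_def pointed_models_def kripke_model_def image_mono)
  moreover have "isomorphic Props P (N, f w)"
    unfolding isomorphic_def P prod.case
  proof (intro exI[of _ f] conjI ballI)
    show "bij_betw f (worlds M) (worlds N)" using inj by (simp add: N_def bij_betw_def)
  next
    fix u z assume uz: "u \<in> worlds M" "z \<in> worlds M"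
    show "(u, z) \<in> acc M \<longleftrightarrow> (f u, f z) \<in> acc N"
    proof
      assume "(f u, f z) \<in> acc N"
      then obtain a b where ab: "(a, b) \<in> acc M" "f u = f a" "f z = f b" by (auto simp: N_def)
      then have "u = a" "z = b" using M(3) uz inj by (auto dest: inj_onD)
      with ab show "(u, z) \<in> acc M" by simp
    qed (auto simp: N_def)
  next
    fix u p assume "u \<in> worlds M" "p \<in> Props"
    then show "u \<in> val M p \<longleftrightarrow> f u \<in> val N p"
      using M(4) inj by (auto simp: N_def dest: inj_onD)
  qed simp
  ultimately show ?thesis by blast
qed

lemma sat_injective_homomorphism_point:
  assumes "P \<in> pointed_models Props" "Q \<in> pointed_models Props" "\<phi> \<in> epgml Props"
    and f: "injective_homomorphism Props f P Q" and sat: "sat (fst P) (snd P) \<phi>"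
  shows "sat (fst Q) (snd Q) \<phi>"
proof -
  have "f (snd P) = snd Q"
    using f by (auto simp: injective_homomorphism_def homomorphism_def split: prod.splits)
  then show ?thesis
    using sat_injective_homomorphism[OF f _ assms(3) _ sat] assms(1,2)
    by (auto simp: pointed_models_def kripke_model_def)
qed

lemma sat_isomorphic:
  assumes "P \<in> pointed_models Props" "Q \<in> pointed_models Props" "isomorphic Props P Q"
    and "\<phi> \<in> epgml Props"
  shows "sat (fst P) (snd P) \<phi> \<longleftrightarrow> sat (fst Q) (snd Q) \<phi>"
  using assms sat_injective_homomorphism_point isomorphic_injective_homomorphism isomorphic_sym
  by meson

section \<open>From definability to preservation and invariance\<close>

lemma definable_imp_preserved_inj_hom:
  fixes C :: "('w, 'p) pointed set"
  assumes "C \<subseteq> pointed_models Props" "\<phi> \<in> epgml Props" "definable_by Props C \<phi>"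
  shows "preserved_inj_hom Props C"
  unfolding preserved_inj_hom_def
proof (intro ballI impI)
  fix P Q :: "('w, 'p) pointed"
  assume PQ: "P \<in> C" "Q \<in> pointed_models Props" "\<exists>f. injective_homomorphism Props f P Q"
  have def_C: "sat (fst R) (snd R) \<phi> \<longleftrightarrow> R \<in> C" if "R \<in> pointed_models Props" for R
    using assms(3) that by (auto simp: definable_by_def)
  show "Q \<in> C"
    using PQ assms(1,2) def_C sat_injective_homomorphism_point by blast
qed

lemma definable_imp_unravelling_invariant:
  fixes C :: "('w, 'p) pointed set"
  assumes "infinite (UNIV :: 'w set)" "C \<subseteq> pointed_models Props"
    and "\<phi> \<in> epgml Props" "modal_depth \<phi> \<le> L" "definable_by Props C \<phi>"
  shows "unravelling_invariant Props L C"
  unfolding unravelling_invariant_def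
proof
  fix P :: "('w, 'p) pointed" assume P: "P \<in> pointed_models Props"
  have U: "unravelling L P \<in> pointed_models Props"
    using P by (rule unravelling_pointed_model)
  have def_C: "sat (fst R) (snd R) \<phi> \<longleftrightarrow> R \<in> C" if "R \<in> pointed_models Props" for R
    using assms(5) that by (auto simp: definable_by_def)
  \<comment> \<open>The root is a path of length 1, so the budget of \<open>sat_unravelling\<close>
    is exactly depth at most \<open>L\<close>.\<close>
  have "sat (fst (unravelling L P)) [snd P] \<phi> \<longleftrightarrow> sat (fst P) (last [snd P]) \<phi>"
    using P assms(4) by (intro sat_unravelling)
      (auto simp: pointed_models_def kripke_model_def unr_worlds_def split: prod.splits)
  then have sat_U: "sat (fst (unravelling L P)) (snd (unravelling L P)) \<phi> \<longleftrightarrow> P \<in> C"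
    using def_C[OF P] by (simp add: unravelling_def)
  show "P \<in> C \<longleftrightarrow> belongs Props (unravelling L P) C"
  proof
    assume "P \<in> C"
    obtain Q :: "('w, 'p) pointed" where Q: "Q \<in> pointed_models Props" "isomorphic Props (unravelling L P) Q"
      using ex_isomorphic_copy[OF assms(1) U] by blast
    then have "Q \<in> C" using sat_isomorphic[OF U Q assms(3)] sat_U def_C \<open>P \<in> C\<close> by blast
    with Q(2) show "belongs Props (unravelling L P) C" by (auto simp: belongs_def)
  next
    assume "belongs Props (unravelling L P) C"
    then obtain Q where Q: "Q \<in> C" "isomorphic Props (unravelling L P) Q" by (auto simp: belongs_def)
    then show "P \<in> C"
      using sat_isomorphic[OF U _ Q(2) assms(3)] sat_U def_C assms(2) by blast
  qed
qed

section \<open>From preservation and invariance to a defining formula\<close>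

text \<open>Invariance moves from \<open>P\<close> to its unravelling, preservation from there to
  the unravelling of \<open>Q\<close>, and invariance back to \<open>Q\<close>. The copies
  \<open>P'\<close> and \<open>Q'\<close> stand in for the unravellings, since the class contains
  only models over its own type of worlds.\<close>

lemma sim_closed:
  fixes C :: "('w, 'p) pointed set"
  assumes "infinite (UNIV :: 'w set)" "C \<subseteq> pointed_models Props"
    and "preserved_inj_hom Props C" "unravelling_invariant Props L C"
    and "P \<in> C" "Q \<in> pointed_models Props" "sim Props L P Q"
  shows "Q \<in> C"
proof -
  have P: "P \<in> pointed_models Props" using assms(2,5) by blast
  have UP: "unravelling L P \<in> pointed_models Props" and UQ: "unravelling L Q \<in> pointed_models Props"
    using P assms(6) by (simp_all add: unravelling_pointed_model)
  obtain P' where P': "P' \<in> C" "isomorphic Props (unravelling L P) P'"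
    using assms(4,5) P unfolding unravelling_invariant_def belongs_def by blast
  obtain Q' :: "('w, 'p) pointed" where Q': "Q' \<in> pointed_models Props" "isomorphic Props (unravelling L Q) Q'"
    using ex_isomorphic_copy[OF assms(1) UQ] by blast
  obtain f where "injective_homomorphism Props f P' (unravelling L P)"
    using isomorphic_injective_homomorphism[OF isomorphic_sym[OF P'(2) UP]] by blast
  moreover obtain g where "injective_homomorphism Props g (unravelling L P) (unravelling L Q)"
    using sim_injective_homomorphism_unravelling[OF P assms(6,7)] by blast
  moreover obtain h where "injective_homomorphism Props h (unravelling L Q) Q'"
    using isomorphic_injective_homomorphism[OF Q'(2)] by blast
  ultimately have "\<exists>k. injective_homomorphism Props k P' Q'"
    by (blast intro: injective_homomorphism_comp)
  then have "Q' \<in> C" using assms(3) P'(1) Q'(1) unfolding preserved_inj_hom_def by blast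
  then have "belongs Props (unravelling L Q) C" using Q'(2) by (auto simp: belongs_def)
  then show "Q \<in> C" using assms(4,6) unfolding unravelling_invariant_def by blast
qed

text \<open>Being upwards closed, the class is the union of the upward closures of the members of a
  finite basis, and each of these closures is defined by a formula.\<close>

lemma sim_closed_imp_definable:
  fixes C :: "('w, 'p) pointed set"
  assumes "finite Props" "C \<subseteq> pointed_models Props"
    and closed: "\<And>P Q. P \<in> C \<Longrightarrow> Q \<in> pointed_models Props \<Longrightarrow> sim Props L P Q \<Longrightarrow> Q \<in> C"
  shows "\<exists>\<phi>\<in>epgml Props. modal_depth \<phi> \<le> L \<and> definable_by Props C \<phi>"
proof -
  from almost_full_on_finite_basis[OF almost_full_on_sim[OF assms(1)] assms(2), of L]
  obtain F where F: "finite F" "F \<subseteq> C" "\<forall>Q\<in>C. \<exists>P\<in>F. sim Props L P Q"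
    by (elim exE conjE)
  have "\<forall>P\<in>F. \<exists>\<phi>. \<phi> \<in> epgml Props \<and> modal_depth \<phi> \<le> L \<and>
    (\<forall>Q\<in>pointed_models Props :: ('w, 'p) pointed set. sat (fst Q) (snd Q) \<phi> \<longleftrightarrow> sim Props L P Q)"
    using epgml_sim[OF assms(1)] F(2) assms(2) by blast
  then obtain c where c: "\<forall>P\<in>F. c P \<in> epgml Props \<and> modal_depth (c P) \<le> L \<and>
    (\<forall>Q\<in>pointed_models Props :: ('w, 'p) pointed set. sat (fst Q) (snd Q) (c P) \<longleftrightarrow> sim Props L P Q)"
    by (auto dest: bchoice)
  have "\<exists>\<psi>\<in>epgml Props. modal_depth \<psi> \<le> L \<and>
    (\<forall>(M :: ('w, 'p) kripke) w. sat M w \<psi> \<longleftrightarrow> (\<exists>\<phi>\<in>c ` F. sat M w \<phi>))"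
    using c F(1) by (intro epgml_big_disj) auto
  then obtain \<psi> where \<psi>: "\<psi> \<in> epgml Props" "modal_depth \<psi> \<le> L"
    "\<forall>(M :: ('w, 'p) kripke) w. sat M w \<psi> \<longleftrightarrow> (\<exists>\<phi>\<in>c ` F. sat M w \<phi>)" by blast
  have "sat (fst Q) (snd Q) \<psi> \<longleftrightarrow> Q \<in> C" if "Q \<in> pointed_models Props" for Q
  proof -
    have "sat (fst Q) (snd Q) \<psi> \<longleftrightarrow> (\<exists>P\<in>F. sim Props L P Q)"
      using \<psi>(3) c that by simp
    then show ?thesis using F closed that by blast
  qed
  then have "definable_by Props C \<psi>" by (force simp: definable_by_def)
  with \<psi>(1,2) show ?thesis by blast
qed

theorem theorem4p7:
  fixes Props :: "'p set" and C :: "('w, 'p) pointed set" and L :: nat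
  assumes "finite Props"
    and "infinite (UNIV :: 'w set)"
    and "C \<subseteq> pointed_models Props"
    and "iso_closed Props C"
  shows "(preserved_inj_hom Props C \<and> unravelling_invariant Props L C) \<longleftrightarrow>
         (\<exists>\<phi>\<in>epgml Props. modal_depth \<phi> \<le> L \<and> definable_by Props C \<phi>)"
proof
  assume "preserved_inj_hom Props C \<and> unravelling_invariant Props L C"
  then show "\<exists>\<phi>\<in>epgml Props. modal_depth \<phi> \<le> L \<and> definable_by Props C \<phi>"
    using sim_closed_imp_definable[OF assms(1,3)] sim_closed[OF assms(2,3)] by blast
next
  assume "\<exists>\<phi>\<in>epgml Props. modal_depth \<phi> \<le> L \<and> definable_by Props C \<phi>"
  then show "preserved_inj_hom Props C \<and> unravelling_invariant Props L C"
    using definable_imp_preserved_inj_hom[OF assms(3)]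
      definable_imp_unravelling_invariant[OF assms(2,3)] by blast
qed

end
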